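(* Let $K/\mathbf Q_p$ be a finite extension with valuation ring $\mathcal O$, let $n\ge1$, and let $F\in\mathcal O[[T]]\otimes K$. If $F$ is $p$-large at $n$, then $$\mu(\pi_n(F))=\mu(F)+I_n(F),\qquad \lambda(\pi_n(F))=\lambda(F)-I_n(F)(p^n-p^{n-1}),$$ where $$I_n(F)=\Big\lfloor\frac{\lambda(F)-p^n}{p^n-p^{n-1}}\Big\rfloor+1.$$
   Context: $p$ is a prime, $\mathrm{ord}_p(p)=1$, $e$ is the ramification index of $K/\mathbf Q_p$, $\omega_n=(1+T)^{p^n}-1$, $\Lambda_K=\mathcal O[[T]]\otimes K$. For nonzero $F=\sum a_iT^i\in\Lambda_K$: $\mu(F)=\min_i\mathrm{ord}_p(a_i)$, $\lambda(F)=\min\{i:\mathrm{ord}_p(a_i)=\mu(F)\}$ (both $\infty$ for $F=0$). $\pi_n:\Lambda_K\to\Lambda_K/(\omega_n)\cong K[T]/(\omega_n)$ is reduction mod $\omega_n$; the Iwasawa invariants of an element of $K[T]/(\omega_n)$ are those of its unique polynomial representative of degree $<p^n$. For an integer $M\geq 0$ let $R(M)\in\{0,\dots,p^n-p^{n-1}-1\}$ and $Q(M)=\lfloor M/(p^n-p^{n-1})\rfloor$ be the remainder and quotient of $M$ on division by $p^n-p^{n-1}$. For $F=\sum a_iT^i$ with invariants $\lambda\ge p^n$ and $\mu$ set $R(F)=R(\lambda-p^n)$, $Q(F)=Q(\lambda-p^n)$ and, for $0\le i\le\lambda-1$, $$v_i(F,n)=\mu+\begin{cases}Q(F)+1+\frac1e&0\le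 i\le R(F)+p^{n-1},\\ Q(F)+1&R(F)+p^{n-1}+1\le i\le p^n-1,\\ Q(F)-Q(i-p^n)+\frac1e&p^n\le i\le\lambda-1,\ R(i-p^n)\le R(F),\\ Q(F)-Q(i-p^n)&p^n\le i\le\lambda-1,\ R(i-p^n)>R(F).\end{cases}$$ $F$ is $p$-large at $n$ if $\lambda\ge p^n$ and $\mathrm{ord}_p(a_i)\ge v_i(F,n)$ for all $0\le i\le\lambda-1$. *)

theory Defs
  imports
    "HOL-Analysis.Analysis"
    "HOL-Computational_Algebra.Computational_Algebra"
begin

section \<open>Finite extensions of the p-adic numbers\<close>

locale additive_valuation =
  fixes w :: "'a::field \<Rightarrow> ereal"
  assumes val_eq_infinity_iff: "w x = \<infinity> \<longleftrightarrow> x = 0"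
    and val_not_minus_infinity: "w x \<noteq> -\<infinity>"
    and val_mult: "w (x * y) = w x + w y"
    and val_add: "min (w x) (w y) \<le> w (x + y)"

definition padic_ord_rat :: "nat \<Rightarrow> rat \<Rightarrow> ereal" where
  "padic_ord_rat p q =
     (if q = 0 then \<infinity>
      else ereal (real (multiplicity (int p) (fst (quotient_of q)))
                - real (multiplicity (int p) (snd (quotient_of q)))))"

text \<open>The libraries do not contain the field of p-adic numbers. As usual, it is the completion of
  the rationals for the p-adic valuation: a valued field extending the rationals with
  their p-adic valuation, in which they are dense, and which is complete. This determines it
  up to a unique isomorphism of valued fields.\<close>

locale padic_numbers = additive_valuation w
  for w :: "'q::field_char_0 \<Rightarrow> ereal" +
  fixes p :: nat
  assumes prime_p: "prime p"
    and val_of_rat: "w (of_rat q) = padic_ord_rat p q"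
    and rat_dense: "\<exists>q. ereal B < w (x - of_rat q)"
    and complete:
      "(\<And>B. \<exists>N::nat. \<forall>m\<ge>N. \<forall>k\<ge>N. ereal B < w (X m - X k)) \<Longrightarrow>
       \<exists>l. \<forall>B. \<exists>N. \<forall>m\<ge>N. ereal B < w (X m - l)"

text \<open>The type \<open>'k\<close> is the extension field \<open>K\<close>, the type \<open>'q\<close> is the field of p-adic numbers,
  embedded by \<open>\<iota>\<close>, and \<open>ordp\<close> is the valuation on \<open>K\<close> with \<open>ordp p = 1\<close>.\<close>

locale finite_padic_extension =
  padic_numbers "\<lambda>c. ordp (\<iota> c)" p + additive_valuation ordp
  for p :: nat and \<iota> :: "'q::field_char_0 \<Rightarrow> 'k::field" and ordp :: "'k \<Rightarrow> ereal" +
  assumes embed_one: "\<iota> 1 = 1"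
    and embed_add: "\<iota> (a + b) = \<iota> a + \<iota> b"
    and embed_mult: "\<iota> (a * b) = \<iota> a * \<iota> b"
    and finite_degree: "\<exists>Basis. finite_dimensional_vector_space (\<lambda>c x. \<iota> c * x) Basis"

text \<open>The index of the value group of the base field in the value group of \<open>K\<close>: the set
  \<open>{ordp (x * \<iota> c) |c. c \<noteq> 0}\<close> is the coset of \<open>ordp x\<close> modulo the former group.\<close>

definition ramification_index :: "('q::field \<Rightarrow> 'k::field) \<Rightarrow> ('k \<Rightarrow> ereal) \<Rightarrow> nat" where
  "ramification_index \<iota> ordp =
     card ((\<lambda>x. {ordp (x * \<iota> c) |c. c \<noteq> 0}) ` {x. x \<noteq> 0})"

definition valuation_ring :: "('k::field \<Rightarrow> ereal) \<Rightarrow> 'k set" where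
  "valuation_ring ordp = {x. 0 \<le> ordp x}"


section \<open>Iwasawa invariants\<close>

text \<open>\<open>\<O>[[T]] \<otimes> K\<close>, as the ring of power series over \<open>K\<close> that are a scalar
  multiple of a power series over the valuation ring.\<close>

definition Lambda_K :: "('k::field \<Rightarrow> ereal) \<Rightarrow> 'k fps set" where
  "Lambda_K ordp =
     {fps_const c * G |c G. \<forall>i. fps_nth G i \<in> valuation_ring ordp}"

text \<open>For a series in \<open>\<O>[[T]] \<otimes> K\<close> over a finite extension the valuation is discrete and the
  infimum is a minimum; it is infinite exactly for the zero series.\<close>

definition iw_mu :: "('k::field \<Rightarrow> ereal) \<Rightarrow> 'k fps \<Rightarrow> ereal" where
  "iw_mu ordp F = (INF i. ordp (fps_nth F i))"

definition iw_lambda :: "('k::field \<Rightarrow> ereal) \<Rightarrow> 'k fps \<Rightarrow> enat" where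
  "iw_lambda ordp F =
     (if F = 0 then \<infinity> else enat (LEAST i. ordp (fps_nth F i) = iw_mu ordp F))"

definition omega :: "nat \<Rightarrow> nat \<Rightarrow> 'k::field fps" where
  "omega p n = (1 + fps_X) ^ (p ^ n) - 1"

text \<open>The image of \<open>F\<close> in \<open>\<O>[[T]] \<otimes> K\<close> modulo \<open>omega p n\<close>, as a residue class.\<close>

definition proj_omega :: "('k::field \<Rightarrow> ereal) \<Rightarrow> nat \<Rightarrow> nat \<Rightarrow> 'k fps \<Rightarrow> 'k fps set" where
  "proj_omega ordp p n F =
     {G \<in> Lambda_K ordp. \<exists>H \<in> Lambda_K ordp. G - F = omega p n * H}"

definition poly_rep :: "nat \<Rightarrow> nat \<Rightarrow> 'k::field fps set \<Rightarrow> 'k poly" where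
  "poly_rep p n C = (THE r. degree r < p ^ n \<and> fps_of_poly r \<in> C)"

definition iw_mu_class :: "('k::field \<Rightarrow> ereal) \<Rightarrow> nat \<Rightarrow> nat \<Rightarrow> 'k fps set \<Rightarrow> ereal" where
  "iw_mu_class ordp p n C = iw_mu ordp (fps_of_poly (poly_rep p n C))"

definition iw_lambda_class :: "('k::field \<Rightarrow> ereal) \<Rightarrow> nat \<Rightarrow> nat \<Rightarrow> 'k fps set \<Rightarrow> enat" where
  "iw_lambda_class ordp p n C = iw_lambda ordp (fps_of_poly (poly_rep p n C))"


section \<open>p-large series\<close>

definition rem_n :: "nat \<Rightarrow> nat \<Rightarrow> nat \<Rightarrow> nat" where
  "rem_n p n M = M mod (p ^ n - p ^ (n - 1))"

definition quot_n :: "nat \<Rightarrow> nat \<Rightarrow> nat \<Rightarrow> nat" where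
  "quot_n p n M = M div (p ^ n - p ^ (n - 1))"

text \<open>The bound \<open>v\<^sub>i(F,n) - \<mu>(F)\<close>, for \<open>F\<close> with lambda-invariant \<open>l \<ge> p ^ n\<close> and for \<open>i < l\<close>;
  \<open>e\<close> is the ramification index.\<close>

definition p_large_bound :: "nat \<Rightarrow> nat \<Rightarrow> nat \<Rightarrow> nat \<Rightarrow> nat \<Rightarrow> real" where
  "p_large_bound p n e l i =
     (let R = rem_n p n (l - p ^ n); Q = quot_n p n (l - p ^ n) in
      if i \<le> R + p ^ (n - 1) then real Q + 1 + 1 / real e
      else if i < p ^ n then real Q + 1
      else if rem_n p n (i - p ^ n) \<le> R then real Q - real (quot_n p n (i - p ^ n)) + 1 / real e
      else real Q - real (quot_n p n (i - p ^ n)))"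

text \<open>Requiring the lambda-invariant to be a natural number excludes the zero series, for which the
  bounds make no sense.\<close>

definition p_large ::
  "('q::field \<Rightarrow> 'k::field) \<Rightarrow> ('k \<Rightarrow> ereal) \<Rightarrow> nat \<Rightarrow> nat \<Rightarrow> 'k fps \<Rightarrow> bool" where
  "p_large \<iota> ordp p n F \<longleftrightarrow>
     (\<exists>l::nat. iw_lambda ordp F = enat l \<and> p ^ n \<le> l \<and>
        (\<forall>i<l. iw_mu ordp F + ereal (p_large_bound p n (ramification_index \<iota> ordp) l i)
                 \<le> ordp (fps_nth F i)))"

text \<open>Only meaningful for \<open>F\<close> with finite lambda-invariant at least \<open>p ^ n\<close>; then the subtraction
  is not truncated.\<close>

definition I_n :: "('k::field \<Rightarrow> ereal) \<Rightarrow> nat \<Rightarrow> nat \<Rightarrow> 'k fps \<Rightarrow> nat" where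
  "I_n ordp p n F = quot_n p n (the_enat (iw_lambda ordp F) - p ^ n) + 1"

end

theory Submission
  imports Defs
begin

text \<open>
  Write \<open>q = p ^ n\<close>, \<open>q' = p ^ (n - 1)\<close>, \<open>d = q - q'\<close> and \<open>\<omega> = (1 + T) ^ q - 1\<close>. The point is how a power
  of \<open>T\<close> behaves modulo \<open>\<omega>\<close>. The series \<open>T ^ q - \<omega>\<close> is divisible by \<open>p\<close>, its coefficient at
  \<open>q'\<close> has valuation exactly \<open>1\<close>, and the earlier ones have valuation at least \<open>2\<close>
  (\<open>X_power_minus_omega\<close>). So reducing \<open>T ^ q\<close> lowers \<open>\<lambda>\<close> by \<open>d\<close> and raises \<open>\<mu>\<close> by \<open>1\<close>. Iterating,
  \<open>T ^ (q + Q * d + R)\<close> with \<open>R < d\<close> is congruent to an integral series with \<open>\<mu> = Q + 1\<close> and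
  \<open>\<lambda> = q' + R\<close> (\<open>X_power_reduction_mod\<close>).

  Apply this to \<open>F\<close> with \<open>\<lambda>(F) = l = q + Q * d + R\<close>. The tail of \<open>F\<close> from \<open>l\<close> on is \<open>T ^ l\<close> times a series
  with \<open>\<lambda> = 0\<close>, so it is congruent to a series with \<open>\<mu> = \<mu>(F) + Q + 1\<close> and
  \<open>\<lambda> = q' + R\<close>. The bounds that define \<open>p\<close>-largeness say that the
  remaining terms, once reduced, do not disturb this (\<open>reduction_of_large_series\<close>). Hence \<open>F\<close> is
  congruent to a series \<open>f\<close> with the predicted invariants.

  Since \<open>\<lambda>(f) = q' + R < q\<close>, the polynomial representative has the same invariants as
  \<open>f\<close>: it is the remainder in the Weierstrass division of \<open>f\<close> by \<open>\<omega>\<close>, and as \<open>\<omega>\<close> is \<open>T ^ q\<close> modulo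
  \<open>p\<close>, this division changes the coefficients below \<open>q\<close> only by terms of valuation at least
  \<open>\<mu>(f) + 1\<close> (\<open>leading_at_remainder\<close>).

  Two properties of \<open>K\<close> enter. Weierstrass division requires completeness, which \<open>K\<close>
  inherits from the base field as a finite-dimensional space (\<open>span_complete\<close>). Discreteness of the
  valuation, a consequence of the finiteness of the ramification index
  (\<open>finite_val_cosets\<close>), makes \<open>\<lambda>(F)\<close> the index of a coefficient of valuation \<open>\<mu>(F)\<close>.
\<close>

unbundle no vec_syntax
unbundle fps_syntax

section \<open>Valued fields\<close>

context additive_valuation
begin

lemma val_0 [simp]: "w 0 = \<infinity>"
  by (simp add: val_eq_infinity_iff)

lemma val_1 [simp]: "w 1 = 0"
proof -
  have "w 1 = w 1 + w 1" using val_mult[of 1 1] by simp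
  moreover have "w 1 \<noteq> \<infinity>" by (simp add: val_eq_infinity_iff)
  ultimately show ?thesis using val_not_minus_infinity[of 1] by (cases "w 1") auto
qed

lemma val_minus [simp]: "w (- x) = w x"
proof -
  have "w (-1) + w (-1) = 0" using val_mult[of "-1" "-1"] by simp
  then have "w (-1) = 0" by (cases "w (-1)") auto
  then show ?thesis using val_mult[of "-1" x] by simp
qed

lemma val_real: "x \<noteq> 0 \<Longrightarrow> \<exists>a. w x = ereal a"
  using val_eq_infinity_iff[of x] val_not_minus_infinity[of x] by (cases "w x") auto

lemma le_val_add: "a \<le> w x \<Longrightarrow> a \<le> w y \<Longrightarrow> a \<le> w (x + y)"
  using val_add[of x y] by (meson min.boundedI order_trans)

lemma le_val_diff: "a \<le> w x \<Longrightarrow> a \<le> w y \<Longrightarrow> a \<le> w (x - y)"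
  using le_val_add[of a x "- y"] by simp

lemma less_val_diff: "a < w x \<Longrightarrow> a < w y \<Longrightarrow> a < w (x - y)"
  using val_add[of x "- y"] less_le_trans[of a "min (w x) (w y)" "w (x - y)"] by simp

lemma le_val_sum: "(\<And>i. i \<in> S \<Longrightarrow> a \<le> w (f i)) \<Longrightarrow> a \<le> w (sum f S)"
  by (induction S rule: infinite_finite_induct) (auto intro: le_val_add)

lemma less_val_sum:
  assumes "finite S" and "a < \<infinity>" and "\<And>i. i \<in> S \<Longrightarrow> a < w (f i)"
  shows "a < w (sum f S)"
  using assms(1,3)
proof (induction S rule: finite_induct)
  case empty
  then show ?case using assms(2) by simp
next
  case (insert x S)
  then have "a < min (w (f x)) (w (sum f S))" by simp
  also have "\<dots> \<le> w (f x + sum f S)" by (rule val_add)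
  finally show ?case using insert by simp
qed

lemma le_val_mult:
  assumes "ereal a \<le> w x" and "ereal b \<le> w y"
  shows "ereal (a + b) \<le> w (x * y)"
  using add_mono[OF assms] by (simp add: val_mult)

lemma val_add_eq:
  assumes "w x = ereal a" and "ereal a < w y"
  shows "w (x + y) = ereal a"
proof (rule antisym)
  have "min (w (x + y)) (w y) \<le> ereal a"
    using val_add[of "x + y" "- y"] assms(1) by simp
  then show "w (x + y) \<le> ereal a" using assms(2) by (auto simp: min_def split: if_splits)
  show "ereal a \<le> w (x + y)" using assms by (intro le_val_add) auto
qed

lemma zero_if_val_unbounded:
  assumes "\<And>m::nat. ereal (a + real m) \<le> w x"
  shows "x = 0"
proof (rule ccontr)
  assume "x \<noteq> 0"
  then obtain b where "w x = ereal b" using val_real by blast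
  moreover obtain m :: nat where "b - a < real m" using reals_Archimedean2 by blast
  ultimately show False using assms[of m] by simp
qed

section \<open>Lower bounds for coefficients and the leading index\<close>

definition coeffs_ge :: "real \<Rightarrow> 'a fps \<Rightarrow> bool" where
  "coeffs_ge a F \<longleftrightarrow> (\<forall>i. ereal a \<le> w (F $ i))"

lemma coeffs_ge_0 [simp]: "coeffs_ge a 0"
  by (simp add: coeffs_ge_def)

lemma coeffs_ge_add: "coeffs_ge a F \<Longrightarrow> coeffs_ge a G \<Longrightarrow> coeffs_ge a (F + G)"
  by (simp add: coeffs_ge_def le_val_add)

lemma coeffs_ge_diff: "coeffs_ge a F \<Longrightarrow> coeffs_ge a G \<Longrightarrow> coeffs_ge a (F - G)"
  by (simp add: coeffs_ge_def le_val_diff)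

lemma coeffs_ge_sum: "(\<And>i. i \<in> S \<Longrightarrow> coeffs_ge a (f i)) \<Longrightarrow> coeffs_ge a (sum f S)"
  by (simp add: coeffs_ge_def fps_sum_nth le_val_sum)

lemma coeffs_ge_mult: "coeffs_ge a F \<Longrightarrow> coeffs_ge b G \<Longrightarrow> coeffs_ge (a + b) (F * G)"
  unfolding coeffs_ge_def fps_mult_nth by (blast intro: le_val_sum le_val_mult)

lemma coeffs_ge_shift: "coeffs_ge a F \<Longrightarrow> coeffs_ge a (fps_shift k F)"
  by (simp add: coeffs_ge_def)

lemma coeffs_ge_X_power [simp]: "coeffs_ge 0 (fps_X ^ k)"
  by (simp add: coeffs_ge_def)

lemma coeffs_ge_const: "ereal a \<le> w c \<Longrightarrow> coeffs_ge a (fps_const c)"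
  by (simp add: coeffs_ge_def)

lemma coeffs_ge_mono: "coeffs_ge b F \<Longrightarrow> a \<le> b \<Longrightarrow> coeffs_ge a F"
  unfolding coeffs_ge_def by (meson ereal_less_eq(3) order_trans)

text \<open>For \<open>\<epsilon> > 0\<close> this says that the invariants of \<open>F\<close> are \<open>\<mu> = k\<close> and \<open>\<lambda> = m\<close>, with a gap
  of at least \<open>\<epsilon>\<close> between \<open>k\<close> and the valuations of the coefficients before the \<open>m\<close>-th. Integral
  series allow the gap \<open>1\<close>, which has to be tracked in order to iterate reductions; series
  over \<open>K\<close> allow the gap \<open>1 / e\<close>.\<close>

definition leading_at :: "real \<Rightarrow> real \<Rightarrow> nat \<Rightarrow> 'a fps \<Rightarrow> bool" where
  "leading_at \<epsilon> k m F \<longleftrightarrow>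
     coeffs_ge k F \<and> (\<forall>i<m. ereal (k + \<epsilon>) \<le> w (F $ i)) \<and> w (F $ m) = ereal k"

lemma leading_at_mono: "leading_at \<delta> k m F \<Longrightarrow> \<epsilon> \<le> \<delta> \<Longrightarrow> leading_at \<epsilon> k m F"
  unfolding leading_at_def by (meson add_left_mono ereal_less_eq(3) order_trans)

lemma leading_at_add:
  assumes "leading_at \<epsilon> k m F" and "0 < \<epsilon>"
    and "coeffs_ge k G" and "\<And>i. i \<le> m \<Longrightarrow> ereal (k + \<epsilon>) \<le> w (G $ i)"
  shows "leading_at \<epsilon> k m (F + G)"
proof -
  have "ereal k < w (G $ m)" using assms(2) assms(4)[of m] less_le_trans[of "ereal k" "ereal (k + \<epsilon>)" "w (G $ m)"] by simp
  with assms show ?thesis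
    unfolding leading_at_def by (auto intro: coeffs_ge_add le_val_add val_add_eq)
qed

text \<open>In the coefficient of index \<open>m + m'\<close> of the product, every term other than \<open>F $ m * G $ m'\<close>
  contains an early coefficient of one of the factors, which supplies the gap. So the
  invariants \<open>\<mu>\<close> and \<open>\<lambda>\<close> are additive.\<close>

lemma leading_at_mult:
  assumes F: "leading_at \<epsilon> k m F" and G: "leading_at \<epsilon> k' m' G" and "0 < \<epsilon>"
  shows "leading_at \<epsilon> (k + k') (m + m') (F * G)"
proof -
  have all: "coeffs_ge (k + k') (F * G)"
    using F G by (simp add: leading_at_def coeffs_ge_mult)
  have prod_ge: "ereal (k + k' + \<epsilon>) \<le> w (F $ i * G $ j)" if "i < m \<or> j < m'" for i j
    using that
  proof
    assume "i < m"
    then have "ereal ((k + \<epsilon>) + k') \<le> w (F $ i * G $ j)"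
      using F G by (intro le_val_mult) (auto simp: leading_at_def coeffs_ge_def)
    then show ?thesis by (simp add: ac_simps)
  next
    assume "j < m'"
    then have "ereal (k + (k' + \<epsilon>)) \<le> w (F $ i * G $ j)"
      using F G by (intro le_val_mult) (auto simp: leading_at_def coeffs_ge_def)
    then show ?thesis by (simp add: ac_simps)
  qed
  have low: "ereal (k + k' + \<epsilon>) \<le> w ((F * G) $ i)" if "i < m + m'" for i
    unfolding fps_mult_nth using that by (intro le_val_sum prod_ge) auto
  define rest where "rest = (\<Sum>i\<in>{0..m + m'} - {m}. F $ i * G $ (m + m' - i))"
  have rest: "ereal (k + k' + \<epsilon>) \<le> w rest"
    unfolding rest_def by (intro le_val_sum prod_ge) auto
  have "(F * G) $ (m + m') = F $ m * G $ m' + rest"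
    unfolding fps_mult_nth rest_def by (subst sum.remove[of _ m]) auto
  moreover have "w (F $ m * G $ m') = ereal (k + k')"
    using F G by (simp add: leading_at_def val_mult)
  moreover have "ereal (k + k') < w rest"
    using rest \<open>0 < \<epsilon>\<close> less_le_trans[of "ereal (k + k')" "ereal (k + k' + \<epsilon>)" "w rest"] by simp
  ultimately have "w ((F * G) $ (m + m')) = ereal (k + k')"
    by (metis val_add_eq)
  with all low show ?thesis by (simp add: leading_at_def)
qed

lemma iw_invariants_leading_at:
  assumes "leading_at \<epsilon> k m F" and "0 < \<epsilon>"
  shows "iw_mu w F = ereal k" and "iw_lambda w F = enat m"
proof -
  have m: "w (F $ m) = ereal k" and all: "\<And>i. ereal k \<le> w (F $ i)"
    and low: "\<And>i. i < m \<Longrightarrow> ereal (k + \<epsilon>) \<le> w (F $ i)"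
    using assms(1) by (auto simp: leading_at_def coeffs_ge_def)
  show mu: "iw_mu w F = ereal k"
    unfolding iw_mu_def
  proof (rule antisym)
    show "(INF i. w (F $ i)) \<le> ereal k" using INF_lower[of m UNIV "\<lambda>i. w (F $ i)"] m by simp
    show "ereal k \<le> (INF i. w (F $ i))" using all by (intro INF_greatest) auto
  qed
  have "(LEAST i. w (F $ i) = ereal k) = m"
  proof (rule Least_equality, rule m, rule leI, rule notI)
    fix i assume "w (F $ i) = ereal k" "i < m"
    then show False using low[of i] assms(2) by simp
  qed
  moreover have "F \<noteq> 0" using m by auto
  ultimately show "iw_lambda w F = enat m" by (simp add: iw_lambda_def mu)
qed

text \<open>Membership in \<open>\<O>[[T]] \<otimes> K\<close> becomes a statement about coefficients: a common denominator can be
  chosen as a power of a uniformizer of the base field.\<close>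

lemma Lambda_K_iff_coeffs_ge:
  assumes "w \<pi> = ereal 1"
  shows "F \<in> Lambda_K w \<longleftrightarrow> (\<exists>a. coeffs_ge a F)"
proof
  assume "F \<in> Lambda_K w"
  then obtain c G where F: "F = fps_const c * G" and G: "coeffs_ge 0 G"
    unfolding Lambda_K_def valuation_ring_def coeffs_ge_def zero_ereal_def by blast
  show "\<exists>a. coeffs_ge a F"
  proof (cases "c = 0")
    case False
    then obtain a where "w c = ereal a" using val_real by blast
    then show ?thesis using coeffs_ge_mult[OF coeffs_ge_const G, of a c] F by auto
  qed (simp add: F)
next
  assume "\<exists>a. coeffs_ge a F"
  then obtain a where a: "coeffs_ge a F" by blast
  obtain N :: nat where N: "- a \<le> real N" using real_arch_simple by blast
  have pw: "w (\<pi> ^ N) = ereal (real N)" for N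
    by (induction N) (auto simp: val_mult assms)
  then have nz: "\<pi> ^ N \<noteq> 0" by (metis val_0 PInfty_neq_ereal(1))
  have "coeffs_ge (real N + a) (fps_const (\<pi> ^ N) * F)"
    using a pw by (intro coeffs_ge_mult coeffs_ge_const) auto
  then have "coeffs_ge 0 (fps_const (\<pi> ^ N) * F)"
    by (rule coeffs_ge_mono) (use N in simp)
  moreover have "F = fps_const (inverse (\<pi> ^ N)) * (fps_const (\<pi> ^ N) * F)"
    unfolding mult.assoc[symmetric] fps_const_mult left_inverse[OF nz] by simp
  ultimately show "F \<in> Lambda_K w"
    unfolding Lambda_K_def valuation_ring_def coeffs_ge_def zero_ereal_def by blast
qed

end

section \<open>Weierstrass division over a complete valued field\<close>

definition (in additive_valuation) Cauchy_seq :: "(nat \<Rightarrow> 'a) \<Rightarrow> bool" where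
  "Cauchy_seq X \<longleftrightarrow> (\<forall>B. \<exists>N. \<forall>m\<ge>N. \<forall>k\<ge>N. ereal B < w (X m - X k))"

definition (in additive_valuation) converges_to :: "(nat \<Rightarrow> 'a) \<Rightarrow> 'a \<Rightarrow> bool" where
  "converges_to X l \<longleftrightarrow> (\<forall>B. \<exists>N. \<forall>m\<ge>N. ereal B < w (X m - l))"

locale complete_valuation = additive_valuation w
  for w :: "'a::field \<Rightarrow> ereal" +
  assumes convergent_if_Cauchy: "Cauchy_seq X \<Longrightarrow> \<exists>l. converges_to X l"

lemma (in complete_valuation) limit_with_rate:
  assumes step: "\<And>m::nat. ereal (a + real m) \<le> w (X (Suc m) - X m)"
  shows "\<exists>l. \<forall>m. ereal (a + real m) \<le> w (l - X m)"
proof -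
  have tail: "ereal (a + real m) \<le> w (X (m + j) - X m)" for m j
  proof (induction j)
    case (Suc j)
    have "ereal (a + real m) \<le> w (X (Suc (m + j)) - X (m + j))"
      by (rule order_trans[OF _ step]) simp
    from le_val_add[OF this Suc] show ?case by simp
  qed simp
  have "\<exists>N. \<forall>m\<ge>N. \<forall>k\<ge>N. ereal B < w (X m - X k)" for B
  proof -
    obtain N :: nat where N: "B - a < real N" using reals_Archimedean2 by blast
    have "ereal B < w (X m - X k)" if "m \<ge> N" "k \<ge> N" for m k
    proof -
      have le: "ereal (a + real N) \<le> w (X m - X k)"
        using le_val_diff[of "ereal (a + real N)" "X m - X N" "X k - X N"]
          tail[of N "m - N"] tail[of N "k - N"] that by simp
      have "ereal B < ereal (a + real N)" using N by simp
      from less_le_trans[OF this le] show ?thesis .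
    qed
    then show ?thesis by blast
  qed
  then obtain l where l: "\<And>B. \<exists>N. \<forall>m\<ge>N. ereal B < w (X m - l)"
    using convergent_if_Cauchy unfolding Cauchy_seq_def converges_to_def by blast
  have "ereal (a + real m) \<le> w (l - X m)" for m
  proof -
    obtain N where N: "\<forall>k\<ge>N. ereal (a + real m) < w (X k - l)" using l by blast
    have "ereal (a + real m) \<le> w ((X (m + N) - X m) - (X (m + N) - l))"
      using tail[of m N] N by (intro le_val_diff[of _ "X (m + N) - X m"]) (auto intro: less_imp_le)
    then show ?thesis by simp
  qed
  then show ?thesis by blast
qed

text \<open>The coefficients of \<open>W - fps_X ^ q\<close> are required to have valuation at least \<open>1\<close>, which for \<open>ordp\<close>
  means divisibility by \<open>p\<close> itself and not merely by a uniformizer of \<open>K\<close>. Division by such a series gains a full unit of valuation in each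
  step, whatever the ramification.\<close>

definition (in additive_valuation) distinguished :: "nat \<Rightarrow> 'a fps \<Rightarrow> bool" where
  "distinguished q W \<longleftrightarrow> coeffs_ge 1 (W - fps_X ^ q)"

lemma (in additive_valuation) distinguished_coeffs_ge_0:
  assumes "distinguished q W"
  shows "coeffs_ge 0 W"
proof -
  have "coeffs_ge 0 (W - fps_X ^ q)"
    using assms unfolding distinguished_def by (rule coeffs_ge_mono) simp
  from coeffs_ge_add[OF this coeffs_ge_X_power[of q]] show ?thesis by simp
qed

text \<open>The condition that \<open>W * H\<close> removes all coefficients of \<open>G\<close> from index \<open>q\<close> on is a fixed-point
  equation for the quotient \<open>H\<close>, because \<open>fps_shift q\<close> undoes the multiplication by the leading
  power \<open>fps_X ^ q\<close> of \<open>W\<close>.\<close>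

lemma shift_eq_iff_div:
  fixes W :: "'a::field fps"
  shows "fps_shift q (G - W * H) = 0 \<longleftrightarrow> H = fps_shift q (G - (W - fps_X ^ q) * H)"
proof -
  have "fps_shift q (G - (W - fps_X ^ q) * H) = fps_shift q ((G - W * H) + fps_X ^ q * H)"
    by (simp add: algebra_simps)
  also have "\<dots> = fps_shift q (G - W * H) + H"
    by (simp add: fps_eq_iff fps_X_power_mult_nth)
  finally have eq: "fps_shift q (G - (W - fps_X ^ q) * H) = fps_shift q (G - W * H) + H" .
  show ?thesis unfolding eq by simp
qed

text \<open>The map \<open>step\<close> whose fixed points are the quotients is a contraction, since all
  coefficients of \<open>P = W - fps_X ^ q\<close> have valuation at least \<open>1\<close>. Its iterates converge
  coefficientwise, and the limit inherits the lower bound on the coefficients of the dividend.\<close>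

theorem (in complete_valuation) weierstrass_division:
  assumes W: "distinguished q W" and G: "coeffs_ge a G"
  shows "\<exists>H. coeffs_ge a H \<and> fps_shift q (G - W * H) = 0"
proof -
  define P where "P = W - fps_X ^ q"
  have P: "coeffs_ge 1 P" using W by (simp add: distinguished_def P_def)
  define step where "step H = fps_shift q (G - P * H)" for H
  define H where "H m = (step ^^ m) 0" for m
  have H_Suc: "H (Suc m) = step (H m)" for m by (simp add: H_def)
  have contract: "coeffs_ge (b + 1) (step H1 - step H2)" if "coeffs_ge b (H1 - H2)" for H1 H2 b
  proof -
    have "step H1 - step H2 = fps_shift q (P * (H2 - H1))"
      by (simp add: step_def fps_shift_diff algebra_simps)
    moreover have "coeffs_ge b (H2 - H1)"
      using coeffs_ge_diff[OF coeffs_ge_0 that] by simp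
    ultimately show ?thesis
      using coeffs_ge_shift[OF coeffs_ge_mult[OF P]] by (simp only: add.commute[of b])
  qed
  have diff: "coeffs_ge (a + real m) (H (Suc m) - H m)" for m
  proof (induction m)
    case 0
    then show ?case using G by (simp add: H_def step_def coeffs_ge_shift)
  next
    case (Suc m)
    from contract[OF Suc] show ?case by (simp add: H_Suc ac_simps)
  qed
  have "\<exists>l. \<forall>m. ereal (a + real m) \<le> w (l - H m $ i)" for i
    using diff by (intro limit_with_rate) (simp add: coeffs_ge_def)
  then obtain l where l: "\<And>i m. ereal (a + real m) \<le> w (l i - H m $ i)" by metis
  define L where "L = Abs_fps l"
  have L: "coeffs_ge (a + real m) (L - H m)" for m using l by (simp add: L_def coeffs_ge_def)
  have "coeffs_ge (a + real m) (L - step L)" for m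
  proof -
    have "coeffs_ge (a + real m) (L - H (Suc m))"
      by (rule coeffs_ge_mono[OF L]) simp
    moreover have "coeffs_ge (a + real m) (step L - step (H m))"
      by (rule coeffs_ge_mono[OF contract[OF L]]) simp
    ultimately have "coeffs_ge (a + real m) ((L - H (Suc m)) - (step L - step (H m)))"
      by (rule coeffs_ge_diff)
    then show ?thesis by (simp add: H_Suc)
  qed
  then have "(L - step L) $ i = 0" for i
    using zero_if_val_unbounded[of a "(L - step L) $ i"] unfolding coeffs_ge_def by blast
  then have "L - step L = 0" by (intro fps_ext) simp
  then have "fps_shift q (G - W * L) = 0"
    unfolding shift_eq_iff_div step_def P_def by (rule iffD1[OF right_minus_eq])
  moreover have "coeffs_ge a L" using L[of 0] by (simp add: H_def)
  ultimately show ?thesis by blast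
qed

text \<open>A quotient of zero is a fixed point of a linear contraction: every lower bound for its
  coefficients improves itself by \<open>1\<close>.\<close>

theorem (in additive_valuation) weierstrass_division_unique:
  assumes W: "distinguished q W" and H: "coeffs_ge a H" and 0: "fps_shift q (W * H) = 0"
  shows "H = 0"
proof -
  have "fps_shift q (0 - W * H) = 0" unfolding fps_shift_diff 0 by simp
  then have eq: "H = fps_shift q (0 - (W - fps_X ^ q) * H)"
    by (rule iffD1[OF shift_eq_iff_div])
  have "coeffs_ge (a + real m) H" for m
  proof (induction m)
    case (Suc m)
    have "coeffs_ge (1 + (a + real m)) ((W - fps_X ^ q) * H)"
      using W Suc by (intro coeffs_ge_mult) (auto simp: distinguished_def)
    then have "coeffs_ge (1 + (a + real m)) (fps_shift q (0 - (W - fps_X ^ q) * H))"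
      by (intro coeffs_ge_shift coeffs_ge_diff coeffs_ge_0)
    then show ?case unfolding eq[symmetric] by (simp add: ac_simps)
  qed (simp add: H)
  then have "H $ i = 0" for i
    using zero_if_val_unbounded[of a "H $ i"] unfolding coeffs_ge_def by blast
  then show ?thesis by (intro fps_ext) simp
qed

text \<open>Below index \<open>q\<close> only the coefficients of \<open>W - fps_X ^ q\<close> contribute to \<open>W * H\<close>, so there the
  remainder agrees with the dividend up to valuation \<open>k + 1\<close>. Hence a series with
  \<open>\<lambda> < q\<close> keeps its invariants when it is reduced.\<close>

lemma (in additive_valuation) leading_at_remainder:
  assumes W: "distinguished q W" and f: "leading_at \<epsilon> k m f" and "m < q" "0 < \<epsilon>" "\<epsilon> \<le> 1"
    and H: "coeffs_ge k H" and 0: "fps_shift q (f - W * H) = 0"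
  shows "leading_at \<epsilon> k m (f - W * H)"
proof -
  have nth: "(W * H) $ i = ((W - fps_X ^ q) * H) $ i" if "i < q" for i
    using that by (simp add: left_diff_distrib fps_X_power_mult_nth)
  have "coeffs_ge (1 + k) ((W - fps_X ^ q) * H)"
    using W H by (intro coeffs_ge_mult) (auto simp: distinguished_def)
  then have low: "ereal (k + 1) \<le> w ((W * H) $ i)" if "i < q" for i
    using nth[OF that] by (simp add: coeffs_ge_def add.commute)
  have "coeffs_ge k (- (W * H))"
    using coeffs_ge_diff[OF coeffs_ge_0 coeffs_ge_mult[OF distinguished_coeffs_ge_0[OF W] H]] by simp
  moreover have "ereal (k + \<epsilon>) \<le> w ((- (W * H)) $ i)" if "i \<le> m" for i
    using low[of i] that \<open>m < q\<close> \<open>\<epsilon> \<le> 1\<close> order_trans[of "ereal (k + \<epsilon>)" "ereal (k + 1)"] by simp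
  ultimately have "leading_at \<epsilon> k m (f + - (W * H))"
    using f \<open>0 < \<epsilon>\<close> by (intro leading_at_add)
  then show ?thesis by simp
qed

section \<open>Finite extensions of the p-adic numbers: completeness and discreteness\<close>

text \<open>This is the locale \<open>finite_padic_extension\<close> with a prefix that separates the facts on
  the valuation of the base field from those on the valuation of \<open>K\<close>.\<close>

locale padic_field =
  base: padic_numbers "\<lambda>c. ordp (\<iota> c)" p + additive_valuation ordp
  for p :: nat and \<iota> :: "'q::field_char_0 \<Rightarrow> 'k::field" and ordp :: "'k \<Rightarrow> ereal" +
  assumes embed_one: "\<iota> 1 = 1"
    and embed_add: "\<iota> (a + b) = \<iota> a + \<iota> b"
    and embed_mult: "\<iota> (a * b) = \<iota> a * \<iota> b"
    and finite_degree: "\<exists>Basis. finite_dimensional_vector_space (\<lambda>c x. \<iota> c * x) Basis"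

lemma padic_field_if_finite_padic_extension:
  assumes "finite_padic_extension p \<iota> ordp"
  shows "padic_field p \<iota> ordp"
  using assms unfolding finite_padic_extension_def finite_padic_extension_axioms_def
    padic_field_def padic_field_axioms_def by blast

lemma multiplicity_of_int: "multiplicity (int p) (int m) = multiplicity p m"
  unfolding multiplicity_def by (simp flip: of_nat_power)

context padic_field
begin

lemma embed_0 [simp]: "\<iota> 0 = 0"
  using embed_add[of 0 0] by (metis add_0_left add_cancel_right_right)

lemma embed_minus: "\<iota> (- c) = - \<iota> c"
  using embed_add[of c "- c"] by (simp add: eq_neg_iff_add_eq_0 add.commute)

lemma embed_diff: "\<iota> (a - b) = \<iota> a - \<iota> b"
  using embed_add[of a "- b"] by (simp add: embed_minus)

lemma embed_inverse: "c \<noteq> 0 \<Longrightarrow> \<iota> c * \<iota> (inverse c) = 1"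
  by (simp flip: embed_mult add: embed_one)

lemma embed_eq_0_iff [simp]: "\<iota> c = 0 \<longleftrightarrow> c = 0"
  using embed_inverse[of c] by fastforce

lemma embed_of_nat: "\<iota> (of_nat m) = of_nat m"
  by (induction m) (simp_all add: embed_add embed_one)

sublocale ext: vector_space "\<lambda>c x. \<iota> c * x"
  by unfold_locales (auto simp: algebra_simps embed_add embed_mult embed_one)

text \<open>A complete subspace is closed, so a vector outside of it has positive distance from it.\<close>

lemma span_closed:
  assumes complete: "\<And>X. (\<And>m. X m \<in> ext.span S) \<Longrightarrow> Cauchy_seq X \<Longrightarrow>
      \<exists>l\<in>ext.span S. converges_to X l"
    and b: "b \<notin> ext.span S"
  shows "\<exists>B. \<forall>s\<in>ext.span S. ordp (b - s) \<le> ereal B"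
proof (rule ccontr)
  assume "\<not> ?thesis"
  then have "\<forall>m::nat. \<exists>s\<in>ext.span S. ereal (real m) < ordp (b - s)"
    by (meson not_le)
  then obtain s where s: "\<And>m. s m \<in> ext.span S" "\<And>m. ereal (real m) < ordp (b - s m)"
    by metis
  have late: "ereal B < ordp (b - s m)" if "B < real N" "N \<le> m" for B N m
    using that by (intro less_trans[OF _ s(2)]) simp
  have "Cauchy_seq s"
    unfolding Cauchy_seq_def
  proof
    fix B
    obtain N :: nat where N: "B < real N" using reals_Archimedean2 by blast
    have "ereal B < ordp (s m - s k)" if "N \<le> m" "N \<le> k" for m k
      using less_val_diff[OF late[OF N that(2)] late[OF N that(1)]] by simp
    then show "\<exists>N. \<forall>m\<ge>N. \<forall>k\<ge>N. ereal B < ordp (s m - s k)" by blast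
  qed
  then obtain l where l: "l \<in> ext.span S" "converges_to s l"
    using complete s(1) by blast
  have "ereal (0 + real j) \<le> ordp (b - l)" for j
  proof -
    obtain N where N: "\<forall>m\<ge>N. ereal (real j) < ordp (s m - l)"
      using l(2) unfolding converges_to_def by blast
    define m where "m = Suc (N + j)"
    have "ereal (real j) < ordp (b - s m)" by (rule late[of _ "Suc j"]) (simp_all add: m_def)
    moreover have "ereal (real j) < ordp (s m - l)" using N by (simp add: m_def)
    ultimately have "ereal (real j) \<le> ordp ((b - s m) + (s m - l))"
      by (intro le_val_add less_imp_le)
    then show ?thesis by simp
  qed
  then have "b - l = 0" by (rule zero_if_val_unbounded)
  with l(1) b show False by simp
qed

text \<open>Induction on the number of generators. If \<open>b\<close> has positive distance from the span of \<open>S\<close>,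
  then the \<open>b\<close>-coordinates of a Cauchy sequence are Cauchy in the base field, because a small
  vector must have a small \<open>b\<close>-coordinate; subtracting the \<open>b\<close>-components leaves a Cauchy
  sequence in the span of \<open>S\<close>.\<close>

lemma span_complete:
  assumes "finite S"
  shows "(\<And>m. X m \<in> ext.span S) \<Longrightarrow> Cauchy_seq X \<Longrightarrow> \<exists>l\<in>ext.span S. converges_to X l"
  using assms
proof (induction S arbitrary: X rule: finite_induct)
  case empty
  then show ?case by (intro bexI[of _ 0]) (auto simp: converges_to_def)
next
  case (insert b S)
  show ?case
  proof (cases "b \<in> ext.span S")
    case True
    then show ?thesis using insert ext.span_redundant by metis
  next
    case False
    then have "b \<noteq> 0" using ext.span_zero by auto
    then obtain \<beta> where \<beta>: "ordp b = ereal \<beta>" using val_real by blast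
    obtain B0 where B0: "\<And>s. s \<in> ext.span S \<Longrightarrow> ordp (b - s) \<le> ereal B0"
      using span_closed[OF insert.IH False] by blast
    have "\<forall>m. \<exists>c. X m - \<iota> c * b \<in> ext.span S"
      using insert.prems(1) ext.span_insert[of b S] by blast
    then obtain c where c: "\<And>m. X m - \<iota> (c m) * b \<in> ext.span S" by metis
    define d where "d m = X m - \<iota> (c m) * b" for m
    have c_bound: "ordp (X m - X k) \<le> ordp (\<iota> (c m - c k)) + ereal B0" for m k
    proof (cases "c m - c k = 0")
      case False
      \<comment> \<open>scaled to \<open>b\<close>-coordinate \<open>1\<close>, the difference is \<open>b - s\<close>, and the distance of \<open>b\<close> from the span applies\<close>
      define s where "s = \<iota> (- inverse (c m - c k)) * (d m - d k)"
      have "s \<in> ext.span S"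
        unfolding s_def d_def by (intro ext.span_scale ext.span_diff c)
      moreover have "X m - X k = \<iota> (c m - c k) * (b - s)"
      proof -
        have "\<iota> (c m - c k) * s = - (\<iota> (c m - c k) * \<iota> (inverse (c m - c k))) * (d m - d k)"
          unfolding s_def embed_minus by (simp only: mult.assoc mult_minus_left mult_minus_right)
        also have "\<dots> = - (d m - d k)" unfolding embed_inverse[OF False] by simp
        finally show ?thesis by (simp add: right_diff_distrib d_def embed_diff left_diff_distrib)
      qed
      ultimately show ?thesis using B0[of s] by (simp add: val_mult add_left_mono)
    qed simp
    have "base.Cauchy_seq c"
      unfolding base.Cauchy_seq_def
    proof
      fix B
      obtain N where N: "\<forall>m\<ge>N. \<forall>k\<ge>N. ereal (B + B0) < ordp (X m - X k)"
        using insert.prems(2) unfolding Cauchy_seq_def by blast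
      have "ereal B < ordp (\<iota> (c m - c k))" if "N \<le> m" "N \<le> k" for m k
        using less_le_trans[OF N[rule_format, OF that] c_bound]
        by (cases "ordp (\<iota> (c m - c k))") auto
      then show "\<exists>N. \<forall>m\<ge>N. \<forall>k\<ge>N. ereal B < ordp (\<iota> (c m - c k))" by blast
    qed
    then obtain c' where c': "base.converges_to c c'"
      using base.complete unfolding base.Cauchy_seq_def base.converges_to_def by blast
    have mult_b: "ereal B < ordp (\<iota> x * b)" if "ereal (B - \<beta>) < ordp (\<iota> x)" for B x
      using that by (cases "ordp (\<iota> x)") (auto simp: val_mult \<beta>)
    have "Cauchy_seq d"
      unfolding Cauchy_seq_def
    proof
      fix B
      obtain N1 where N1: "\<forall>m\<ge>N1. \<forall>k\<ge>N1. ereal B < ordp (X m - X k)"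
        using insert.prems(2) unfolding Cauchy_seq_def by blast
      obtain N2 where N2: "\<forall>m\<ge>N2. \<forall>k\<ge>N2. ereal (B - \<beta>) < ordp (\<iota> (c m - c k))"
        using \<open>base.Cauchy_seq c\<close> unfolding base.Cauchy_seq_def by blast
      have "ereal B < ordp (d m - d k)" if "max N1 N2 \<le> m" "max N1 N2 \<le> k" for m k
      proof -
        have "d m - d k = (X m - X k) - \<iota> (c m - c k) * b"
          by (simp add: d_def embed_diff algebra_simps)
        moreover have "ereal B < ordp (X m - X k)" and "ereal B < ordp (\<iota> (c m - c k) * b)"
          using N1 N2 that by (auto intro: mult_b)
        ultimately show ?thesis using less_val_diff by simp
      qed
      then show "\<exists>N. \<forall>m\<ge>N. \<forall>k\<ge>N. ereal B < ordp (d m - d k)" by blast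
    qed
    then obtain s where s: "s \<in> ext.span S" "converges_to d s"
      using insert.IH[of d] c unfolding d_def by blast
    have "converges_to X (\<iota> c' * b + s)"
      unfolding converges_to_def
    proof
      fix B
      obtain N1 where N1: "\<forall>m\<ge>N1. ereal B < ordp (d m - s)"
        using s(2) unfolding converges_to_def by blast
      obtain N2 where N2: "\<forall>m\<ge>N2. ereal (B - \<beta>) < ordp (\<iota> (c m - c'))"
        using c' unfolding base.converges_to_def by blast
      have "ereal B < ordp (X m - (\<iota> c' * b + s))" if "max N1 N2 \<le> m" for m
      proof -
        have "ereal (B - \<beta>) < ordp (\<iota> (- (c m - c')))"
          using N2 that by (simp only: base.val_minus)
        then have "ereal B < ordp (\<iota> (- (c m - c')) * b)" by (rule mult_b)
        moreover have "ereal B < ordp (d m - s)" using N1 that by simp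
        ultimately have "ereal B < ordp ((d m - s) - \<iota> (- (c m - c')) * b)"
          by (intro less_val_diff[of _ "d m - s"])
        also have "(d m - s) - \<iota> (- (c m - c')) * b = X m - (\<iota> c' * b + s)"
          by (simp add: d_def embed_diff algebra_simps)
        finally show ?thesis .
      qed
      then show "\<exists>N. \<forall>m\<ge>N. ereal B < ordp (X m - (\<iota> c' * b + s))" by blast
    qed
    moreover have "\<iota> c' * b + s \<in> ext.span (insert b S)"
      using s(1) unfolding ext.span_insert[of b S] by (intro CollectI exI[of _ c']) simp
    ultimately show ?thesis by blast
  qed
qed

sublocale complete_valuation ordp
proof
  fix X assume X: "Cauchy_seq X"
  obtain Basis where "finite_dimensional_vector_space (\<lambda>c x. \<iota> c * x) Basis"
    using finite_degree by blast
  then have "finite Basis" "ext.span Basis = UNIV"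
    by (auto simp: finite_dimensional_vector_space_def finite_dimensional_vector_space_axioms_def)
  with span_complete[OF \<open>finite Basis\<close> _ X] show "\<exists>l. converges_to X l" by auto
qed

text \<open>By density a nonzero p-adic number has the same valuation as some rational number.\<close>

lemma embed_val_integral:
  assumes "c \<noteq> 0"
  shows "\<exists>z::int. ordp (\<iota> c) = ereal (real_of_int z)"
proof -
  obtain v where v: "ordp (\<iota> c) = ereal v" using val_real[of "\<iota> c"] assms by auto
  obtain q where q: "ereal v < ordp (\<iota> (c - of_rat q))" using base.rat_dense by blast
  have "ordp (\<iota> (c + - (c - of_rat q))) = ereal v"
    using q by (intro base.val_add_eq v) (simp only: base.val_minus)
  then have "padic_ord_rat p q = ereal v" by (simp flip: base.val_of_rat)
  then have "v = real_of_int (int (multiplicity (int p) (fst (quotient_of q)))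
      - int (multiplicity (int p) (snd (quotient_of q))))"
    by (auto simp: padic_ord_rat_def split: if_splits)
  with v show ?thesis by blast
qed

lemma val_of_nat:
  assumes "m > 0"
  shows "ordp (of_nat m) = ereal (real (multiplicity p m))"
proof -
  have "quotient_of (of_nat m) = (int m, 1)"
    using quotient_of_int[of "int m"] by (simp add: Rat.of_int_def)
  then have "ordp (\<iota> (of_rat (of_nat m))) = ereal (real (multiplicity (int p) (int m)))"
    unfolding base.val_of_rat padic_ord_rat_def using assms by simp
  then show ?thesis by (simp add: embed_of_nat multiplicity_of_int)
qed

definition val_coset :: "'k \<Rightarrow> ereal set" where
  "val_coset x = {ordp (x * \<iota> c) |c. c \<noteq> 0}"

lemma val_coset_eq:
  assumes "ordp (x * \<iota> a) = ordp (y * \<iota> b)" and "a \<noteq> 0" "b \<noteq> 0"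
  shows "val_coset x = val_coset y"
proof -
  have "val_coset x \<subseteq> val_coset y"
    if eq: "ordp (x * \<iota> a) = ordp (y * \<iota> b)" and nz: "a \<noteq> 0" "b \<noteq> 0" for x y a b
  proof
    fix v assume "v \<in> val_coset x"
    then obtain c where c: "v = ordp (x * \<iota> c)" "c \<noteq> 0" by (auto simp: val_coset_def)
    have split: "\<iota> c = \<iota> a * \<iota> (c / a)" using nz by (simp flip: embed_mult)
    have "v = ordp (x * \<iota> a) + ordp (\<iota> (c / a))"
      unfolding c(1) split by (simp add: val_mult mult.assoc ac_simps)
    also have "\<dots> = ordp (y * \<iota> (b * c / a))"
      unfolding eq by (simp flip: val_mult embed_mult add: mult.assoc)
    finally show "v \<in> val_coset y" using c(2) nz by (auto simp: val_coset_def)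
  qed
  from this[OF assms] this[OF assms(1)[symmetric] assms(3,2)] show ?thesis by blast
qed

text \<open>In a linear relation with coefficients in the base field, terms that belong to different cosets of
  the value group have different valuations. So one term is strictly dominant and cannot be
  cancelled.\<close>

lemma independent_if_distinct_cosets:
  assumes "finite X" and "0 \<notin> X" and inj: "inj_on val_coset X"
  shows "ext.independent X"
proof
  assume "ext.dependent X"
  then obtain u where u: "\<exists>v\<in>X. u v \<noteq> 0" and sum: "(\<Sum>v\<in>X. \<iota> (u v) * v) = 0"
    using ext.dependent_finite[OF assms(1)] by auto
  define S where "S = {v \<in> X. u v \<noteq> 0}"
  have S: "finite S" "S \<noteq> {}" using assms(1) u by (auto simp: S_def)
  define x where "x = arg_min_on (\<lambda>v. ordp (\<iota> (u v) * v)) S"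
  have x: "x \<in> S" using arg_min_if_finite(1)[OF S] by (simp add: x_def)
  have min: "ordp (\<iota> (u x) * x) \<le> ordp (\<iota> (u v) * v)" if "v \<in> S" for v
    using arg_min_least[OF S that] by (simp add: x_def)
  have less: "ordp (\<iota> (u x) * x) < ordp (\<iota> (u v) * v)" if "v \<in> S" "v \<noteq> x" for v
  proof -
    have "ordp (\<iota> (u x) * x) \<noteq> ordp (\<iota> (u v) * v)"
      using val_coset_eq[of x "u x" v "u v"] inj_onD[OF inj, of x v] x that
      by (auto simp: S_def mult.commute)
    with min[OF that(1)] show ?thesis by simp
  qed
  have nz: "\<iota> (u x) * x \<noteq> 0" using x assms(2) by (auto simp: S_def)
  then obtain a where a: "ordp (\<iota> (u x) * x) = ereal a" using val_real by blast
  have "ereal a < ordp (\<Sum>v\<in>S - {x}. \<iota> (u v) * v)"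
    using S(1) less a by (intro less_val_sum) auto
  then have "ordp (\<iota> (u x) * x + (\<Sum>v\<in>S - {x}. \<iota> (u v) * v)) = ereal a"
    by (rule val_add_eq[OF a])
  moreover have "(\<Sum>v\<in>X. \<iota> (u v) * v) = (\<Sum>v\<in>S. \<iota> (u v) * v)"
    using assms(1) by (intro sum.mono_neutral_right) (auto simp: S_def)
  ultimately show False using sum sum.remove[OF S(1) x, of "\<lambda>v. \<iota> (u v) * v"] by simp
qed

text \<open>This is the inequality \<open>e \<le> [K : Q\<^sub>p]\<close>. It is what makes \<open>ramification_index\<close> the true index:
  for infinitely many cosets \<open>card\<close> would be \<open>0\<close>, and the bounds with \<open>1 / e\<close> would not be
  strict.\<close>

lemma finite_val_cosets: "finite (val_coset ` {x. x \<noteq> 0})"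
proof -
  obtain Basis where "finite_dimensional_vector_space (\<lambda>c x. \<iota> c * x) Basis"
    using finite_degree by blast
  then interpret fd: finite_dimensional_vector_space "\<lambda>c x. \<iota> c * x" Basis .
  have "card D \<le> ext.dim UNIV" if D: "D \<subseteq> val_coset ` {x. x \<noteq> 0}" "finite D" for D
  proof -
    obtain X where X: "X \<subseteq> {x. x \<noteq> 0}" "inj_on val_coset X" "D = val_coset ` X"
      using subset_image_inj[of D val_coset "{x. x \<noteq> 0}"] D(1) by auto
    then have "finite X" using D(2) finite_image_iff by blast
    then have "card X \<le> ext.dim UNIV"
      using X by (intro fd.independent_card_le_dim independent_if_distinct_cosets) auto
    then show ?thesis using X card_image by metis
  qed
  then show ?thesis using finite_if_finite_subsets_card_bdd by blast
qed

lemma ramification_index_pos: "0 < ramification_index \<iota> ordp"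
proof -
  have "ramification_index \<iota> ordp = card (val_coset ` {x. x \<noteq> 0})"
    unfolding ramification_index_def val_coset_def ..
  moreover have "val_coset 1 \<in> val_coset ` {x. x \<noteq> 0}" by simp
  ultimately show ?thesis using finite_val_cosets by (metis card_gt_0_iff empty_iff)
qed

lemma values_mod_integers_finite:
  obtains V :: "real set" where "finite V"
    and "\<And>x. x \<noteq> 0 \<Longrightarrow> \<exists>v\<in>V. \<exists>z::int. ordp x = ereal (v + real_of_int z)"
proof
  let ?rep = "\<lambda>C. real_of_ereal (SOME y. y \<in> C)"
  show "finite (?rep ` val_coset ` {x. x \<noteq> 0})" using finite_val_cosets by blast
  fix x :: 'k assume x: "x \<noteq> 0"
  then obtain r where r: "ordp x = ereal r" using val_real by blast
  have "ordp (x * \<iota> 1) \<in> val_coset x" unfolding val_coset_def by force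
  then have "(SOME y. y \<in> val_coset x) \<in> val_coset x" by (rule someI)
  then obtain c where c: "c \<noteq> 0" "(SOME y. y \<in> val_coset x) = ordp (x * \<iota> c)"
    by (auto simp: val_coset_def)
  obtain z :: int where "ordp (\<iota> c) = ereal (real_of_int z)" using embed_val_integral c(1) by blast
  then have "ordp x = ereal (?rep (val_coset x) + real_of_int (- z))"
    by (simp add: c(2) val_mult r)
  then show "\<exists>v\<in>?rep ` val_coset ` {x. x \<noteq> 0}. \<exists>z::int. ordp x = ereal (v + real_of_int z)"
    using x by blast
qed

text \<open>The value group is a finite union of translates of the integers, so only finitely many values
  lie between a lower bound and the valuation of a given nonzero coefficient. Therefore the
  infimum is a minimum and the index \<open>\<lambda>\<close> is meaningful.\<close>

lemma iw_mu_attained: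
  assumes "coeffs_ge a F" and "F \<noteq> 0"
  shows "\<exists>i. ordp (F $ i) = iw_mu ordp F"
proof -
  obtain i0 where i0: "F $ i0 \<noteq> 0" using assms(2) by (auto simp: fps_eq_iff)
  then obtain r0 where r0: "ordp (F $ i0) = ereal r0" using val_real by blast
  obtain V where V: "finite V"
    "\<And>x. x \<noteq> 0 \<Longrightarrow> \<exists>v\<in>V. \<exists>z::int. ordp x = ereal (v + real_of_int z)"
    using values_mod_integers_finite by blast
  define S where "S = {r. r \<le> r0 \<and> (\<exists>i. ordp (F $ i) = ereal r)}"
  have "S \<subseteq> (\<Union>v\<in>V. (\<lambda>z. v + real_of_int z) ` {\<lfloor>a - v\<rfloor>..\<lceil>r0 - v\<rceil>})"
  proof
    fix r assume "r \<in> S"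
    then obtain i where i: "r \<le> r0" "ordp (F $ i) = ereal r" by (auto simp: S_def)
    then have "F $ i \<noteq> 0" by auto
    then obtain v z where vz: "v \<in> V" "ordp (F $ i) = ereal (v + real_of_int z)" using V(2) by blast
    have "a \<le> r" using assms(1) i(2) unfolding coeffs_ge_def by (metis ereal_less_eq(3))
    with i vz have "z \<in> {\<lfloor>a - v\<rfloor>..\<lceil>r0 - v\<rceil>}" by (simp add: floor_le_iff le_ceiling_iff; linarith)
    with vz i(2) show "r \<in> (\<Union>v\<in>V. (\<lambda>z. v + real_of_int z) ` {\<lfloor>a - v\<rfloor>..\<lceil>r0 - v\<rceil>})"
      by (intro UN_I[of v] image_eqI[of _ _ z]) auto
  qed
  then have fin: "finite S" using V(1) finite_subset by blast
  have "r0 \<in> S" using r0 by (auto simp: S_def)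
  then have "Min S \<in> S" using fin Min_in by blast
  then obtain i where i: "ordp (F $ i) = ereal (Min S)" by (auto simp: S_def)
  have "ordp (F $ i) \<le> ordp (F $ j)" for j
  proof (cases "ordp (F $ j) \<le> ereal r0")
    case True
    then obtain r where "ordp (F $ j) = ereal r"
      using val_not_minus_infinity[of "F $ j"] by (cases "ordp (F $ j)") auto
    with True have "r \<in> S" by (auto simp: S_def)
    then show ?thesis using fin i \<open>ordp (F $ j) = ereal r\<close> by simp
  next
    case False
    have "Min S \<le> r0" using fin \<open>r0 \<in> S\<close> by simp
    with False i show ?thesis by (metis ereal_less_eq(3) linear order_trans)
  qed
  then have "iw_mu ordp F = ordp (F $ i)"
    unfolding iw_mu_def by (intro antisym INF_lower INF_greatest) auto
  then show ?thesis by metis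
qed

end

section \<open>Reduction of powers of the variable\<close>

context additive_valuation
begin

lemma leading_at_X_power: "leading_at \<epsilon> 0 k (fps_X ^ k)"
  by (auto simp: leading_at_def)

text \<open>Passing from \<open>Q\<close> to \<open>Q + 1\<close> multiplies by \<open>fps_X ^ d\<close> and thereby moves the leading index
  \<open>q'\<close> exactly to \<open>q\<close>. The part from index \<open>q\<close> on then has its leading coefficient in front, and
  replacing \<open>fps_X ^ q\<close> by \<open>fps_X ^ q - W\<close> brings the leading index back to \<open>q'\<close> at the cost of
  one unit of valuation. The part below \<open>q\<close> comes from coefficients before the leading one;
  these already had the extra unit of valuation, but they must in addition stay away from the
  indices up to \<open>q'\<close>. The condition \<open>q' \<le> d\<close> ensures this for indices below \<open>q'\<close>, and in the
  case \<open>q' = d\<close>, which occurs for \<open>p = 2\<close>, the vanishing constant coefficient \<open>f $ 0\<close> is needed for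
  the index \<open>q'\<close> itself.\<close>

lemma X_power_reduction:
  assumes W: "leading_at 1 1 q' (fps_X ^ q - W)" and W0: "(fps_X ^ q - W) $ 0 = 0"
    and q: "q = q' + d" and "q' \<le> d"
  shows "\<exists>f h. leading_at 1 (real Q + 1) q' f \<and> f $ 0 = 0 \<and> coeffs_ge 0 h
    \<and> f = fps_X ^ (q + Q * d) + W * h"
proof (induction Q)
  case 0
  have "coeffs_ge 0 (- 1)" by (simp add: coeffs_ge_def fps_eq_iff)
  moreover have "fps_X ^ q - W = fps_X ^ (q + 0 * d) + W * (- 1)" by simp
  ultimately show ?case
    using W W0 by (intro exI[of _ "fps_X ^ q - W"] exI[of _ "- 1"]) auto
next
  case (Suc Q)
  then obtain f h where f: "leading_at 1 (real Q + 1) q' f" and f0: "f $ 0 = 0"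
    and h: "coeffs_ge 0 h" and eq: "f = fps_X ^ (q + Q * d) + W * h" by blast
  define g where "g = fps_X ^ d * f"
  have g_nth: "g $ j = (if j < d then 0 else f $ (j - d))" for j
    by (simp add: g_def fps_X_power_mult_nth)
  have f_ge: "ereal (real Q + 1) \<le> w (f $ j)" and f_low: "j < q' \<Longrightarrow> ereal (real Q + 1 + 1) \<le> w (f $ j)"
    and f_q': "w (f $ q') = ereal (real Q + 1)" for j
    using f by (auto simp: leading_at_def coeffs_ge_def)
  \<comment> \<open>index \<open>q + j\<close> of \<open>g\<close> is index \<open>q' + j\<close> of \<open>f\<close>, so the leading coefficient moves to the front\<close>
  have high: "leading_at 1 (real Q + 1) 0 (fps_shift q g)"
    unfolding leading_at_def coeffs_ge_def using f_ge f_q' by (auto simp: g_nth q)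
  have top: "leading_at 1 (1 + (real Q + 1)) (q' + 0) ((fps_X ^ q - W) * fps_shift q g)"
    by (intro leading_at_mult W high) simp
  have low_ge: "coeffs_ge (1 + (real Q + 1)) (fps_cutoff q g)"
    unfolding coeffs_ge_def using f_low by (auto simp: g_nth q ac_simps)
  \<comment> \<open>an index \<open>j \<le> q' \<le> d\<close> of \<open>g\<close> is below \<open>d\<close>, or it is \<open>d\<close> and corresponds to \<open>f $ 0\<close>\<close>
  have low_zero: "fps_cutoff q g $ j = 0" if "j \<le> q'" for j
    using that \<open>q' \<le> d\<close> f0 by (auto simp: g_nth)
  have "leading_at 1 (1 + (real Q + 1)) (q' + 0)
      ((fps_X ^ q - W) * fps_shift q g + fps_cutoff q g)"
    using low_zero by (intro leading_at_add top low_ge) auto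
  moreover have split: "(fps_X ^ q - W) * fps_shift q g + fps_cutoff q g = g - W * fps_shift q g"
    using fps_shift_cutoff'[of q g] by (simp add: algebra_simps)
  ultimately have lead: "leading_at 1 (real (Suc Q) + 1) q' (g - W * fps_shift q g)"
    by (simp add: ac_simps)
  have zero: "(g - W * fps_shift q g) $ 0 = 0"
    unfolding split[symmetric] using W0 low_zero[of 0] by simp
  have "coeffs_ge (0 + 0) (fps_X ^ d * h)"
    by (intro coeffs_ge_mult coeffs_ge_X_power h)
  moreover have "coeffs_ge 0 (fps_shift q g)"
    using coeffs_ge_mono[of "real Q + 1" "fps_shift q g" 0] high by (simp add: leading_at_def)
  ultimately have "coeffs_ge 0 (fps_X ^ d * h - fps_shift q g)"
    by (intro coeffs_ge_diff) auto
  moreover have "g - W * fps_shift q g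
      = fps_X ^ (q + Suc Q * d) + W * (fps_X ^ d * h - fps_shift q g)"
    by (simp add: g_def eq algebra_simps power_add)
  ultimately show ?case using lead zero by blast
qed

lemma X_power_reduction_mod:
  assumes W: "leading_at 1 1 q' (fps_X ^ q - W)" and W0: "(fps_X ^ q - W) $ 0 = 0"
    and q: "q = q' + d" and "q' \<le> d" and "q \<le> i"
  shows "\<exists>f h. leading_at 1 (real ((i - q) div d) + 1) (q' + (i - q) mod d) f \<and> coeffs_ge 0 h
    \<and> f = fps_X ^ i + W * h"
proof -
  define Q R where "Q = (i - q) div d" and "R = (i - q) mod d"
  obtain f h where f: "leading_at 1 (real Q + 1) q' f" "coeffs_ge 0 h" "f = fps_X ^ (q + Q * d) + W * h"
    using X_power_reduction[OF W W0 q \<open>q' \<le> d\<close>] by blast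
  have "q + Q * d + R = i" using \<open>q \<le> i\<close> by (simp add: Q_def R_def)
  then have "f * fps_X ^ R = fps_X ^ i + W * (h * fps_X ^ R)"
    unfolding f(3) by (simp add: distrib_right mult.assoc flip: power_add)
  moreover have "leading_at 1 (real Q + 1 + 0) (q' + R) (f * fps_X ^ R)"
    by (intro leading_at_mult f leading_at_X_power) simp
  moreover have "coeffs_ge (0 + 0) (h * fps_X ^ R)"
    by (intro coeffs_ge_mult f coeffs_ge_X_power)
  ultimately show ?thesis unfolding Q_def R_def
    by (intro exI[of _ "f * fps_X ^ R"] exI[of _ "h * fps_X ^ R"]) (simp add: R_def)
qed

lemma fps_split_at:
  fixes F :: "'a fps"
  assumes "q \<le> l"
  shows "F = fps_cutoff q F + (\<Sum>i\<in>{q..<l}. fps_const (F $ i) * fps_X ^ i) + fps_X ^ l * fps_shift l F"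
proof (rule fps_ext)
  fix j
  have "(\<Sum>i\<in>{q..<l}. fps_const (F $ i) * fps_X ^ i) $ j = (\<Sum>i\<in>{q..<l}. if i = j then F $ i else 0)"
    unfolding fps_sum_nth by (intro sum.cong) auto
  also have "\<dots> = (if j \<in> {q..<l} then F $ j else 0)" by simp
  finally show "F $ j = (fps_cutoff q F + (\<Sum>i\<in>{q..<l}. fps_const (F $ i) * fps_X ^ i)
      + fps_X ^ l * fps_shift l F) $ j"
    using assms by (auto simp: fps_X_power_mult_nth)
qed

text \<open>Replace each power \<open>fps_X ^ i\<close> with \<open>q \<le> i \<le> l\<close> by its reduction, and the tail of \<open>F\<close> from \<open>l\<close> on by
  the reduction of \<open>fps_X ^ l\<close> times the shifted tail; no infinite sum of reductions occurs.
  The tail contributes the leading term at \<open>R + q'\<close> with valuation \<open>\<mu> + Q + 1\<close>. The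
  bounds on the earlier coefficients are exactly what keeps all other contributions from
  interfering: for \<open>i\<close> with quotient \<open>Q(i)\<close> and remainder \<open>R(i)\<close>, the reduction of \<open>fps_X ^ i\<close> has
  \<open>\<mu> = Q(i) + 1\<close> and \<open>\<lambda> = q' + R(i)\<close>, so for \<open>R(i) > R\<close> it is late enough, and for
  \<open>R(i) \<le> R\<close> the coefficient of \<open>F\<close> has to supply the gap \<open>\<epsilon>\<close>.\<close>

theorem reduction_of_large_series:
  assumes W: "leading_at 1 1 q' (fps_X ^ q - W)" and W0: "(fps_X ^ q - W) $ 0 = 0"
    and q: "q = q' + d" and "q' \<le> d" and "q \<le> l" and \<epsilon>: "0 < \<epsilon>" "\<epsilon> \<le> 1"
    and F: "coeffs_ge \<mu> F" and Fl: "w (F $ l) = ereal \<mu>"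
    and Q: "Q = (l - q) div d" and R: "R = (l - q) mod d"
    and low: "\<And>i. i < q \<Longrightarrow> ereal (\<mu> + (real Q + 1)) \<le> w (F $ i)"
      "\<And>i. i \<le> R + q' \<Longrightarrow> ereal (\<mu> + (real Q + 1 + \<epsilon>)) \<le> w (F $ i)"
    and mid: "\<And>i. q \<le> i \<Longrightarrow> i < l \<Longrightarrow> ereal (\<mu> + (real Q - real ((i - q) div d))) \<le> w (F $ i)"
      "\<And>i. q \<le> i \<Longrightarrow> i < l \<Longrightarrow> (i - q) mod d \<le> R \<Longrightarrow>
        ereal (\<mu> + (real Q - real ((i - q) div d) + \<epsilon>)) \<le> w (F $ i)"
  shows "\<exists>f h. leading_at \<epsilon> (\<mu> + (real Q + 1)) (R + q') f \<and> coeffs_ge \<mu> h \<and> f = F + W * h"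
proof -
  let ?k = "\<mu> + (real Q + 1)"
  have "\<exists>f h. q \<le> i \<longrightarrow> leading_at 1 (real ((i - q) div d) + 1) (q' + (i - q) mod d) f \<and> coeffs_ge 0 h
    \<and> f = fps_X ^ i + W * h" for i
    using X_power_reduction_mod[OF W W0 q \<open>q' \<le> d\<close>, of i] by auto
  then obtain f h where
    f: "\<And>i. q \<le> i \<Longrightarrow> leading_at 1 (real ((i - q) div d) + 1) (q' + (i - q) mod d) (f i)"
    and h: "\<And>i. q \<le> i \<Longrightarrow> coeffs_ge 0 (h i)"
    and eq: "\<And>i. q \<le> i \<Longrightarrow> f i = fps_X ^ i + W * h i"
    by metis
  define M where "M = (\<Sum>i\<in>{q..<l}. fps_const (F $ i) * f i)"
  define top where "top = f l * fps_shift l F"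
  define hh where "hh = (\<Sum>i\<in>{q..<l}. fps_const (F $ i) * h i) + fps_shift l F * h l"

  have "leading_at \<epsilon> \<mu> 0 (fps_shift l F)"
    using F Fl by (simp add: leading_at_def coeffs_ge_shift)
  then have "leading_at \<epsilon> ((real Q + 1) + \<mu>) ((q' + R) + 0) top"
    unfolding top_def using leading_at_mono[OF f[OF \<open>q \<le> l\<close>] \<epsilon>(2)] \<epsilon>(1)
    by (intro leading_at_mult) (auto simp: Q R)
  then have top: "leading_at \<epsilon> ?k (R + q') top" by (simp add: ac_simps)

  have M_ge: "coeffs_ge ?k M"
    unfolding M_def
  proof (rule coeffs_ge_sum)
    fix i assume i: "i \<in> {q..<l}"
    have "coeffs_ge ((\<mu> + (real Q - real ((i - q) div d))) + (real ((i - q) div d) + 1))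
        (fps_const (F $ i) * f i)"
      using i f[of i] mid(1)[of i] by (intro coeffs_ge_mult coeffs_ge_const) (auto simp: leading_at_def)
    then show "coeffs_ge ?k (fps_const (F $ i) * f i)" by (rule coeffs_ge_mono) simp
  qed
  have M_low: "ereal (?k + \<epsilon>) \<le> w (M $ j)" if j: "j \<le> R + q'" for j
    unfolding M_def fps_sum_nth
  proof (rule le_val_sum)
    fix i assume i: "i \<in> {q..<l}"
    let ?Qi = "real ((i - q) div d)"
    have "ereal (?k + \<epsilon>) \<le> w (F $ i * f i $ j)"
    proof (cases "(i - q) mod d \<le> R")
      case True
      have "ereal ((\<mu> + (real Q - ?Qi + \<epsilon>)) + (?Qi + 1)) \<le> w (F $ i * f i $ j)"
        using i True f[of i] mid(2)[of i]
        by (intro le_val_mult) (auto simp: leading_at_def coeffs_ge_def)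
      then show ?thesis by (simp add: algebra_simps)
    next
      case False
      have "ereal ((\<mu> + (real Q - ?Qi)) + (?Qi + 1 + 1)) \<le> w (F $ i * f i $ j)"
        using i j False f[of i] mid(1)[of i]
        by (intro le_val_mult) (auto simp: leading_at_def coeffs_ge_def)
      moreover have "ereal (?k + \<epsilon>) \<le> ereal ((\<mu> + (real Q - ?Qi)) + (?Qi + 1 + 1))"
        using \<epsilon>(2) by simp
      ultimately show ?thesis by (rule order_trans[rotated])
    qed
    then show "ereal (?k + \<epsilon>) \<le> w ((fps_const (F $ i) * f i) $ j)" by simp
  qed
  have "R < d \<or> d = 0" by (auto simp: R)
  then have cutoff_low: "ereal (?k + \<epsilon>) \<le> w (fps_cutoff q F $ j)" if "j \<le> R + q'" for j
    using low(2)[OF that] by (auto simp: add.assoc)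
  have cutoff_ge: "coeffs_ge ?k (fps_cutoff q F)"
    unfolding coeffs_ge_def using low(1) by auto
  have "ereal (?k + \<epsilon>) \<le> w ((fps_cutoff q F + M) $ j)" if "j \<le> R + q'" for j
    unfolding fps_add_nth by (intro le_val_add cutoff_low M_low that)
  then have lead: "leading_at \<epsilon> ?k (R + q') (top + (fps_cutoff q F + M))"
    by (intro leading_at_add top \<epsilon> coeffs_ge_add cutoff_ge M_ge)

  have "coeffs_ge (\<mu> + 0) (fps_const (F $ i) * h i)" if "i \<in> {q..<l}" for i
    using h that F by (intro coeffs_ge_mult coeffs_ge_const) (auto simp: coeffs_ge_def)
  moreover have "coeffs_ge (\<mu> + 0) (fps_shift l F * h l)"
    using F h \<open>q \<le> l\<close> by (intro coeffs_ge_mult coeffs_ge_shift)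
  ultimately have hh: "coeffs_ge \<mu> hh"
    unfolding hh_def by (intro coeffs_ge_add coeffs_ge_sum) simp_all

  have "M = (\<Sum>i\<in>{q..<l}. fps_const (F $ i) * fps_X ^ i) + W * (\<Sum>i\<in>{q..<l}. fps_const (F $ i) * h i)"
    unfolding M_def sum_distrib_left sum.distrib[symmetric]
    by (intro sum.cong) (auto simp: eq algebra_simps)
  then have "top + (fps_cutoff q F + M) = (fps_cutoff q F
      + (\<Sum>i\<in>{q..<l}. fps_const (F $ i) * fps_X ^ i) + fps_X ^ l * fps_shift l F) + W * hh"
    by (simp add: top_def hh_def eq[OF \<open>q \<le> l\<close>] algebra_simps)
  also have "\<dots> = F + W * hh" using fps_split_at[OF \<open>q \<le> l\<close>, of F] by simp
  finally show ?thesis using lead hh by blast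
qed

end

section \<open>The coefficients of omega\<close>

lemma nth_one_plus_X_power: "((1 + fps_X) ^ N :: 'a::comm_ring_1 fps) $ j = of_nat (N choose j)"
proof (induction N arbitrary: j)
  case (Suc N)
  then show ?case by (cases j) (auto simp: distrib_right)
qed (auto simp: binomial_eq_0)

text \<open>Absorption: \<open>j * (p ^ n choose j) = p ^ n * ((p ^ n - 1) choose (j - 1))\<close>.\<close>

lemma multiplicity_prime_power_choose:
  fixes p :: nat
  assumes "prime p" and "0 < j" "j \<le> p ^ n"
  shows "multiplicity p j + multiplicity p (p ^ n choose j)
    = n + multiplicity p ((p ^ n - 1) choose (j - 1))"
proof -
  have "j * (p ^ n choose j) = p ^ n * ((p ^ n - 1) choose (j - 1))"
    using times_binomial_minus1_eq[OF \<open>0 < j\<close>] by simp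
  moreover have "(p ^ n choose j) \<noteq> 0" "((p ^ n - 1) choose (j - 1)) \<noteq> 0"
    using assms by (auto simp: binomial_eq_0_iff)
  moreover have "prime_elem p" using assms(1) by simp
  ultimately show ?thesis
    using assms prime_elem_multiplicity_mult_distrib[of p j "p ^ n choose j"]
      prime_elem_multiplicity_mult_distrib[of p "p ^ n" "(p ^ n - 1) choose (j - 1)"]
    by (simp add: multiplicity_same_power not_prime_0)
qed

lemma multiplicity_less_if_less_power:
  fixes p :: nat
  assumes "prime p" and "0 < j" "j < p ^ n"
  shows "multiplicity p j < n"
proof -
  have "p ^ multiplicity p j \<le> j" using assms by (intro dvd_imp_le multiplicity_dvd) auto
  then have "p ^ multiplicity p j < p ^ n" using assms by simp
  then show ?thesis using prime_gt_1_nat[OF assms(1)] power_less_imp_less_exp by blast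
qed

text \<open>Two neighbours in row \<open>p ^ n - 1\<close> of Pascal's triangle add up to a multiple of \<open>p\<close>, so
  non-divisibility spreads from the first entry \<open>1\<close> through the row.\<close>

lemma not_dvd_prime_power_minus_1_choose:
  fixes p :: nat
  assumes "prime p"
  shows "j < p ^ n \<Longrightarrow> \<not> p dvd ((p ^ n - 1) choose j)"
proof (induction j)
  case 0
  then show ?case using assms by (auto simp: prime_nat_iff)
next
  case (Suc j)
  have "multiplicity p (p ^ n choose Suc j) > 0"
    using multiplicity_prime_power_choose[OF assms, of "Suc j" n]
      multiplicity_less_if_less_power[OF assms, of "Suc j" n] Suc.prems by simp
  then have "p dvd (p ^ n choose Suc j)" using not_dvd_imp_multiplicity_0 by fastforce
  moreover have "p ^ n choose Suc j = ((p ^ n - 1) choose j) + ((p ^ n - 1) choose Suc j)"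
    using Suc.prems by (cases "p ^ n") auto
  ultimately show ?case using Suc by (metis Suc_lessD dvd_add_left_iff)
qed

context padic_field
begin

lemma prime_p: "prime p"
  by (rule base.prime_p)

text \<open>The series is \<open>- (\<Sum>j = 1..<p ^ n. (p ^ n choose j) * fps_X ^ j)\<close>. By absorption the valuation of
  such a binomial coefficient is at least \<open>n\<close> minus that of \<open>j\<close>, hence at least \<open>2\<close> before index
  \<open>p ^ (n - 1)\<close>; it is exactly \<open>1\<close> at this index because row \<open>p ^ n - 1\<close> of Pascal's triangle
  contains no multiple of \<open>p\<close>.\<close>

lemma X_power_minus_omega:
  assumes "n \<ge> 1"
  shows "leading_at 1 1 (p ^ (n - 1)) (fps_X ^ (p ^ n) - omega p n)"
    and "(fps_X ^ (p ^ n) - omega p n :: 'k fps) $ 0 = 0"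
proof -
  define S :: "'k fps" where "S = fps_X ^ (p ^ n) - omega p n"
  have p: "p > 1" using prime_p prime_gt_1_nat by blast
  then have pn: "0 < p ^ n" "p ^ (n - 1) < p ^ n" "0 < p ^ (n - 1)"
    using assms by (auto intro: power_strict_increasing)
  have nth: "S $ j = (if 0 < j \<and> j < p ^ n then - of_nat (p ^ n choose j) else 0)" for j
    using pn(1) by (auto simp: S_def omega_def nth_one_plus_X_power binomial_eq_0)
  show "(fps_X ^ (p ^ n) - omega p n :: 'k fps) $ 0 = 0" unfolding S_def[symmetric] nth by simp
  have val: "ordp (S $ j) = ereal (real (multiplicity p (p ^ n choose j)))" if "0 < j" "j < p ^ n" for j
    using that by (simp add: nth val_of_nat)
  have ge1: "1 \<le> multiplicity p (p ^ n choose j)" if "0 < j" "j < p ^ n" for j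
    using multiplicity_prime_power_choose[OF prime_p, of j n]
      multiplicity_less_if_less_power[OF prime_p, of j n] that by simp
  have ge2: "2 \<le> multiplicity p (p ^ n choose j)" if "0 < j" "j < p ^ (n - 1)" for j
    using multiplicity_prime_power_choose[OF prime_p, of j n]
      multiplicity_less_if_less_power[OF prime_p, of j "n - 1"] that pn by simp
  have "multiplicity p ((p ^ n - 1) choose (p ^ (n - 1) - 1)) = 0"
    using pn by (intro not_dvd_imp_multiplicity_0 not_dvd_prime_power_minus_1_choose prime_p) simp
  then have eq1: "multiplicity p (p ^ n choose p ^ (n - 1)) = 1"
    using multiplicity_prime_power_choose[OF prime_p, of "p ^ (n - 1)" n] pn p assms
    by (simp add: multiplicity_same_power)
  have "ereal 1 \<le> ordp (S $ j)" for j
    using val[of j] ge1[of j] by (cases "0 < j \<and> j < p ^ n") (auto simp: nth)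
  moreover have "ereal (1 + 1) \<le> ordp (S $ j)" if "j < p ^ (n - 1)" for j
    using val[of j] ge2[of j] that pn by (cases "0 < j") (auto simp: nth)
  moreover have "ordp (S $ (p ^ (n - 1))) = ereal 1"
    using val[of "p ^ (n - 1)"] eq1 pn by simp
  ultimately show "leading_at 1 1 (p ^ (n - 1)) (fps_X ^ (p ^ n) - omega p n)"
    unfolding S_def[symmetric] leading_at_def coeffs_ge_def by blast
qed

lemma distinguished_omega: "n \<ge> 1 \<Longrightarrow> distinguished (p ^ n) (omega p n)"
  using coeffs_ge_diff[OF coeffs_ge_0, of 1 "fps_X ^ (p ^ n) - omega p n"] X_power_minus_omega(1)[of n]
  unfolding distinguished_def leading_at_def by simp

lemma Lambda_K_iff: "F \<in> Lambda_K ordp \<longleftrightarrow> (\<exists>a. coeffs_ge a F)"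
proof (rule Lambda_K_iff_coeffs_ge)
  have "0 < p" using prime_p prime_gt_0_nat by blast
  then show "ordp (of_nat p) = ereal 1" using prime_p by (simp add: val_of_nat multiplicity_prime)
qed

section \<open>Invariants of p-large series modulo omega\<close>

text \<open>Identifies the representative chosen by \<open>poly_rep\<close>: any bounded series in the class without
  coefficients from index \<open>p ^ n\<close> on is it, by uniqueness of Weierstrass division.\<close>

lemma poly_rep_proj_omega:
  assumes "n \<ge> 1" and h: "coeffs_ge a h" and r: "coeffs_ge b r"
    and r_eq: "r = F + omega p n * h" and r_deg: "fps_shift (p ^ n) r = 0"
  shows "fps_of_poly (poly_rep p n (proj_omega ordp p n F)) = r"
proof -
  define s where "s = (\<Sum>i<p ^ n. monom (r $ i) i)"
  have coeff_s: "coeff s j = (if j < p ^ n then r $ j else 0)" for j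
    unfolding s_def by (simp add: coeff_sum)
  have "r $ j = 0" if "p ^ n \<le> j" for j
    using arg_cong[OF r_deg, of "\<lambda>G. G $ (j - p ^ n)"] that by simp
  then have s: "fps_of_poly s = r" by (intro fps_ext) (auto simp: coeff_s)
  have "0 < p ^ n" using prime_p prime_gt_0_nat by simp
  then have "degree s \<le> p ^ n - 1" by (intro degree_le) (auto simp: coeff_s)
  then have deg: "degree s < p ^ n" using \<open>0 < p ^ n\<close> by linarith
  have "poly_rep p n (proj_omega ordp p n F) = s"
    unfolding poly_rep_def
  proof (rule the_equality)
    have "fps_of_poly s - F = omega p n * h" by (simp add: s r_eq)
    moreover have "h \<in> Lambda_K ordp" and "fps_of_poly s \<in> Lambda_K ordp"
      using h r by (auto simp: Lambda_K_iff s)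
    ultimately show "degree s < p ^ n \<and> fps_of_poly s \<in> proj_omega ordp p n F"
      using deg unfolding proj_omega_def by auto
  next
    fix t assume t: "degree t < p ^ n \<and> fps_of_poly t \<in> proj_omega ordp p n F"
    then obtain H where "H \<in> Lambda_K ordp" and H: "fps_of_poly t - F = omega p n * H"
      unfolding proj_omega_def by auto
    then obtain c where c: "coeffs_ge c H" using Lambda_K_iff by blast
    have diff: "fps_of_poly t - fps_of_poly s = omega p n * (H - h)"
      using H by (simp add: s r_eq algebra_simps)
    have "fps_shift (p ^ n) (fps_of_poly t) = 0"
      using t by (intro fps_ext) (simp add: coeff_eq_0)
    then have "fps_shift (p ^ n) (omega p n * (H - h)) = 0"
      unfolding diff[symmetric] fps_shift_diff s r_deg by simp
    moreover have "coeffs_ge (min c a) (H - h)"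
      using c h by (intro coeffs_ge_diff) (auto intro: coeffs_ge_mono)
    ultimately have "H - h = 0"
      using weierstrass_division_unique[OF distinguished_omega[OF \<open>n \<ge> 1\<close>]] by blast
    with diff have "fps_of_poly t = fps_of_poly s" by simp
    then show "t = s" by (simp add: fps_of_poly_eq_iff)
  qed
  with s show ?thesis by simp
qed

text \<open>Reduce in two stages: \<open>reduction_of_large_series\<close> gives a series in the class of \<open>F\<close> with the
  predicted invariants and \<open>\<lambda> < p ^ n\<close>, and Weierstrass division turns it into the polynomial
  representative without changing the invariants.\<close>

theorem iw_invariants_p_large:
  assumes n: "n \<ge> 1" and F: "F \<in> Lambda_K ordp" and large: "p_large \<iota> ordp p n F"
  shows "iw_mu_class ordp p n (proj_omega ordp p n F)
           = iw_mu ordp F + ereal (real (I_n ordp p n F))"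
    and "iw_lambda_class ordp p n (proj_omega ordp p n F)
           = iw_lambda ordp F - enat (I_n ordp p n F * (p ^ n - p ^ (n - 1)))"
proof -
  define q q' d where "q = p ^ n" and "q' = p ^ (n - 1)" and "d = p ^ n - p ^ (n - 1)"
  obtain l where l: "iw_lambda ordp F = enat l" "q \<le> l"
    and bound: "\<And>i. i < l \<Longrightarrow>
      iw_mu ordp F + ereal (p_large_bound p n (ramification_index \<iota> ordp) l i) \<le> ordp (F $ i)"
    using large unfolding p_large_def q_def by blast
  define Q R where "Q = (l - q) div d" and "R = (l - q) mod d"
  define \<epsilon> where "\<epsilon> = 1 / real (ramification_index \<iota> ordp)"
  have \<epsilon>: "0 < \<epsilon>" "\<epsilon> \<le> 1" using ramification_index_pos by (auto simp: \<epsilon>_def)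

  have "p \<ge> 2" using prime_p prime_ge_2_nat by blast
  then have "2 * q' \<le> p * q'" by simp
  also have "\<dots> = q" using n by (simp add: q_def q'_def power_eq_if)
  finally have "2 * q' \<le> q" .
  moreover have "d = q - q'" by (simp only: d_def q_def q'_def)
  ultimately have "q' \<le> d" and q: "q = q' + d" by simp_all
  moreover have "0 < q'" using \<open>p \<ge> 2\<close> by (simp add: q'_def)
  ultimately have "R < d" by (simp add: R_def)
  then have Rq: "R + q' < q" using q by simp
  have l_eq: "l = q + Q * d + R" using l(2) by (simp add: Q_def R_def)

  have "F \<noteq> 0" using l(1) by (auto simp: iw_lambda_def)
  obtain a where "coeffs_ge a F" using F Lambda_K_iff by blast
  then have "\<exists>i. ordp (F $ i) = iw_mu ordp F" using iw_mu_attained \<open>F \<noteq> 0\<close> by blast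
  from LeastI_ex[OF this] have Fl: "ordp (F $ l) = iw_mu ordp F"
    using l(1) \<open>F \<noteq> 0\<close> by (simp add: iw_lambda_def)
  have mu_le: "iw_mu ordp F \<le> ordp (F $ i)" for i unfolding iw_mu_def by (rule INF_lower) simp
  have "F $ l \<noteq> 0"
  proof
    assume "F $ l = 0"
    then have "ordp (F $ i) = \<infinity>" for i using mu_le[of i] Fl by simp
    then show False using \<open>F \<noteq> 0\<close> by (auto simp: val_eq_infinity_iff fps_eq_iff)
  qed
  then obtain \<mu> where \<mu>: "iw_mu ordp F = ereal \<mu>" using val_real[of "F $ l"] Fl by auto

  have bounds: "ereal (\<mu> + p_large_bound p n (ramification_index \<iota> ordp) l i) \<le> ordp (F $ i)"
    if "i < l" for i using bound[OF that] \<mu> by simp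
  have lb: "p_large_bound p n (ramification_index \<iota> ordp) l i =
     (if i \<le> R + q' then real Q + 1 + \<epsilon>
      else if i < q then real Q + 1
      else if (i - q) mod d \<le> R then real Q - real ((i - q) div d) + \<epsilon>
      else real Q - real ((i - q) div d))" for i
    unfolding p_large_bound_def rem_n_def quot_n_def Let_def Q_def R_def q_def q'_def d_def \<epsilon>_def ..
  have "\<exists>f h. leading_at \<epsilon> (\<mu> + (real Q + 1)) (R + q') f \<and> coeffs_ge \<mu> h \<and> f = F + omega p n * h"
  proof (rule reduction_of_large_series[where q = q and q' = q' and d = d and l = l])
    show "leading_at 1 1 q' (fps_X ^ q - omega p n)" and "(fps_X ^ q - omega p n :: 'k fps) $ 0 = 0"
      unfolding q_def q'_def using X_power_minus_omega[OF n] by auto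
    show "coeffs_ge \<mu> F" using mu_le \<mu> by (simp add: coeffs_ge_def)
    show "ordp (F $ l) = ereal \<mu>" using Fl \<mu> by simp
    show "ereal (\<mu> + (real Q + 1)) \<le> ordp (F $ i)" if "i < q" for i
      using bounds[of i] that l(2) \<epsilon>(1) by (intro order_trans[OF _ bounds]) (auto simp: lb)
    show "ereal (\<mu> + (real Q + 1 + \<epsilon>)) \<le> ordp (F $ i)" if "i \<le> R + q'" for i
      using bounds[of i] that l(2) Rq by (simp add: lb)
    show "ereal (\<mu> + (real Q - real ((i - q) div d))) \<le> ordp (F $ i)" if "q \<le> i" "i < l" for i
      using that Rq \<epsilon>(1) by (intro order_trans[OF _ bounds]) (auto simp: lb)
    show "ereal (\<mu> + (real Q - real ((i - q) div d) + \<epsilon>)) \<le> ordp (F $ i)"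
      if "q \<le> i" "i < l" "(i - q) mod d \<le> R" for i
      using bounds[of i] that Rq by (simp add: lb)
  qed (use q \<open>q' \<le> d\<close> l \<epsilon> Q_def R_def in auto)
  then obtain f h where f: "leading_at \<epsilon> (\<mu> + (real Q + 1)) (R + q') f"
    and h: "coeffs_ge \<mu> h" "f = F + omega p n * h" by blast

  have W: "distinguished q (omega p n)" using distinguished_omega[OF n] by (simp add: q_def)
  have f_ge: "coeffs_ge (\<mu> + (real Q + 1)) f" using f by (simp add: leading_at_def)
  obtain H where H: "coeffs_ge (\<mu> + (real Q + 1)) H" "fps_shift q (f - omega p n * H) = 0"
    using weierstrass_division[OF W f_ge] by blast
  define r where "r = f - omega p n * H"
  have r: "leading_at \<epsilon> (\<mu> + (real Q + 1)) (R + q') r"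
    unfolding r_def by (rule leading_at_remainder[OF W f Rq \<epsilon> H])
  have "fps_of_poly (poly_rep p n (proj_omega ordp p n F)) = r"
  proof (rule poly_rep_proj_omega[OF n])
    show "coeffs_ge \<mu> (h - H)"
      using h H(1) by (intro coeffs_ge_diff) (auto intro: coeffs_ge_mono)
    show "coeffs_ge (\<mu> + (real Q + 1)) r" using r by (simp add: leading_at_def)
    show "r = F + omega p n * (h - H)" by (simp add: r_def h(2) algebra_simps)
    show "fps_shift (p ^ n) r = 0" using H(2) by (simp add: r_def q_def)
  qed
  moreover have I: "I_n ordp p n F = Q + 1"
    by (simp add: I_n_def l(1) quot_n_def Q_def q_def d_def)
  moreover have "R + q' = l - (Q + 1) * d" using l_eq q by (simp add: algebra_simps)
  ultimately show "iw_mu_class ordp p n (proj_omega ordp p n F)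
           = iw_mu ordp F + ereal (real (I_n ordp p n F))"
    and "iw_lambda_class ordp p n (proj_omega ordp p n F)
           = iw_lambda ordp F - enat (I_n ordp p n F * (p ^ n - p ^ (n - 1)))"
    using iw_invariants_leading_at[OF r \<epsilon>(1)]
    by (simp_all add: iw_mu_class_def iw_lambda_class_def \<mu> l(1) d_def)
qed

end

theorem theorem5:
  fixes p n :: nat
    and \<iota> :: "'q::field_char_0 \<Rightarrow> 'k::field"
    and ordp :: "'k \<Rightarrow> ereal"
    and F :: "'k fps"
  assumes "finite_padic_extension p \<iota> ordp"
    and "n \<ge> 1"
    and "F \<in> Lambda_K ordp"
    and "p_large \<iota> ordp p n F"
  shows "iw_mu_class ordp p n (proj_omega ordp p n F)
           = iw_mu ordp F + ereal (real (I_n ordp p n F))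
       \<and> iw_lambda_class ordp p n (proj_omega ordp p n F)
           = iw_lambda ordp F - enat (I_n ordp p n F * (p ^ n - p ^ (n - 1)))"
proof -
  interpret padic_field p \<iota> ordp
    using assms(1) by (rule padic_field_if_finite_padic_extension)
  show ?thesis using iw_invariants_p_large[OF assms(2-4)] by blast
qed

end
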